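(* Let $\mathcal{H}$ be a separable complex Hilbert space, and let $T_0$ and $T_1$ be densely defined, closed, unbounded, symmetric operators in $\mathcal{H}$ satisfying $T_0 \subsetneq T_1$ (i.e., $T_1$ is a proper extension of $T_0$). Let $\mathfrak{E}\subset\mathbb{R}$ be a subset that is not Lebesgue measurable, and define $$\widetilde T(t) = \begin{cases} T_0, & t\in\mathfrak{E},\\ T_1, & t\in\mathbb{R}\setminus\mathfrak{E}.\end{cases}$$ Then the family $\{\widetilde T(t)\}_{t\in\mathbb{R}}$ is weakly measurable, but not $N$-measurable.
   Context: The scalar product $(\cdot,\cdot)_{\mathcal{H}}$ is linear in the second argument. A family of vectors $\{g(t)\}_{t\in\mathbb{R}}\subset\mathcal{H}$ is called weakly measurable if $t\mapsto (h,g(t))_{\mathcal{H}}$ is Lebesgue measurable for every $h\in\mathcal{H}$. A family $\{T(t)\}_{t\in\mathbb{R}}$ of densely defined, closed, linear operators in $\mathcal{H}$ is called weakly measurable if for every weakly measurable family of vectors $\{f(t)\}_{t\in\mathbb{R}}$ in $\mathcal{H}$ with $f(t)\in\operatorname{dom}(T(t))$ for all $t\in\mathbb{R}$, the family of vectors $\{T(t)f(t)\}_{t\in\mathbb{R}}$ is weakly measurable. For a densely defined, closed operator $T$ in $\mathcal{H}$, let $\Gamma(T)=\{\langle f,Tf\rangle : f\in\operatorname{dom}(T)\}\subseteq\mathcal{H}\oplus\mathcal{H}$ be its graph and let $P(\Gamma(T))=(P(\Gamma(T))_{j,k})_{1\le j,k\le 2}$ be the orthogonal projection of $\mathcal{H}\oplus\mathcal{H}$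 onto $\Gamma(T)$, written as a $2\times 2$ block operator matrix with entries in $\mathcal{B}(\mathcal{H})$. The family $\{T(t)\}_{t\in\mathbb{R}}$ is called $N$-measurable if for all $j,k\in\{1,2\}$ the family of bounded operators $\{P(\Gamma(T(t)))_{j,k}\}_{t\in\mathbb{R}}$ is weakly measurable (for families of bounded operators $B(t)$ this is equivalent to $t\mapsto(g,B(t)h)_{\mathcal{H}}$ being Lebesgue measurable for all $g,h\in\mathcal{H}$). *)

theory Defs
  imports "HOL-Analysis.Analysis"
begin

section \<open>Complex Hilbert spaces\<close>

text \<open>
  The real structure underlying a complex inner product space is the library class
  \<^class>\<open>real_inner\<close> with real inner product \<open>Re (x, y)\<close>. Hence norm and topology are those of the
  complex inner product, and a complex Hilbert space is a type of sort
  \<open>{complex_inner, complete_space}\<close>. The scalar product is linear in the second argument.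
\<close>

class complex_vector = real_vector +
  fixes scaleC :: "complex \<Rightarrow> 'a \<Rightarrow> 'a"  (infixr \<open>*\<^sub>C\<close> 75)
  assumes scaleC_add_right: "a *\<^sub>C (x + y) = a *\<^sub>C x + a *\<^sub>C y"
    and scaleC_add_left: "(a + b) *\<^sub>C x = a *\<^sub>C x + b *\<^sub>C x"
    and scaleC_scaleC: "a *\<^sub>C (b *\<^sub>C x) = (a * b) *\<^sub>C x"
    and scaleR_scaleC: "scaleR r x = complex_of_real r *\<^sub>C x"

class complex_inner = complex_vector + real_inner +
  fixes cinner :: "'a \<Rightarrow> 'a \<Rightarrow> complex"
  assumes cinner_commute: "cinner x y = cnj (cinner y x)"
    and cinner_add_right: "cinner x (y + z) = cinner x y + cinner x z"
    and cinner_scaleC_right: "cinner x (a *\<^sub>C y) = a * cinner x y"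
    and inner_eq_Re_cinner: "inner x y = Re (cinner x y)"

lemma scaleC_one: "1 *\<^sub>C x = x" for x :: "'a::complex_vector"
  using scaleR_scaleC[of 1 x] by simp

global_interpretation cvec: vector_space "scaleC :: complex \<Rightarrow> 'a \<Rightarrow> 'a::complex_vector"
  defines csubspace = cvec.subspace
  by unfold_locales (simp_all add: scaleC_add_right scaleC_add_left scaleC_scaleC scaleC_one)

lemma cinner_self: "cinner x x = complex_of_real ((norm x)\<^sup>2)" for x :: "'a::complex_inner"
proof (rule complex_eqI)
  show "Re (cinner x x) = Re (complex_of_real ((norm x)\<^sup>2))"
    using inner_eq_Re_cinner[of x x] by (simp add: power2_norm_eq_inner)
  have "Im (cinner x x) = - Im (cinner x x)"
    by (subst cinner_commute) simp
  then show "Im (cinner x x) = Im (complex_of_real ((norm x)\<^sup>2))"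
    by simp
qed

instantiation complex :: complex_inner
begin

definition scaleC_complex :: "complex \<Rightarrow> complex \<Rightarrow> complex"
  where "scaleC_complex a x = a * x"

definition cinner_complex :: "complex \<Rightarrow> complex \<Rightarrow> complex"
  where "cinner_complex x y = cnj x * y"

instance
  by standard
    (simp_all add: scaleC_complex_def cinner_complex_def inner_complex_def scaleR_conv_of_real
      algebra_simps)

end

text \<open>The orthogonal direct sum of two inner product spaces is the product type.\<close>

instantiation prod :: (complex_vector, complex_vector) complex_vector
begin

definition scaleC_prod :: "complex \<Rightarrow> 'a \<times> 'b \<Rightarrow> 'a \<times> 'b"
  where "scaleC_prod a x = (a *\<^sub>C fst x, a *\<^sub>C snd x)"

instance
  by standard
    (simp_all add: scaleC_prod_def scaleR_prod_def scaleC_add_right scaleC_add_left scaleC_scaleC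
      scaleR_scaleC)

end

instantiation prod :: (complex_inner, complex_inner) complex_inner
begin

definition cinner_prod :: "'a \<times> 'b \<Rightarrow> 'a \<times> 'b \<Rightarrow> complex"
  where "cinner_prod x y = cinner (fst x) (fst y) + cinner (snd x) (snd y)"

instance
proof
  fix x y :: "'a \<times> 'b"
  show "cinner x y = cnj (cinner y x)"
    by (simp add: cinner_prod_def cinner_commute[of "fst x"] cinner_commute[of "snd x"])
qed (simp_all add: cinner_prod_def scaleC_prod_def inner_prod_def cinner_add_right
      cinner_scaleC_right inner_eq_Re_cinner algebra_simps)

end

section \<open>Unbounded operators\<close>

text \<open>
  A (not necessarily everywhere defined) operator is a partial function \<open>T :: 'a \<rightharpoonup> 'a\<close> with domain
  \<open>dom T\<close>, value \<open>the (T x)\<close> at \<open>x \<in> dom T\<close> and graph \<^term>\<open>Map.graph T\<close>. The relation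
  \<open>S \<subseteq> T\<close> of operators is \<^term>\<open>S \<subseteq>\<^sub>m T\<close>.
\<close>

definition linear_operator :: "('a::complex_vector \<rightharpoonup> 'a) \<Rightarrow> bool" where
  "linear_operator T \<longleftrightarrow> csubspace (dom T) \<and>
    (\<forall>x\<in>dom T. \<forall>y\<in>dom T. the (T (x + y)) = the (T x) + the (T y)) \<and>
    (\<forall>c. \<forall>x\<in>dom T. the (T (c *\<^sub>C x)) = c *\<^sub>C the (T x))"

definition densely_defined :: "('a::complex_inner \<rightharpoonup> 'a) \<Rightarrow> bool" where
  "densely_defined T \<longleftrightarrow> closure (dom T) = UNIV"

definition closed_operator :: "('a::complex_inner \<rightharpoonup> 'a) \<Rightarrow> bool" where
  "closed_operator T \<longleftrightarrow> closed (Map.graph T)"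

definition bounded_operator :: "('a::complex_inner \<rightharpoonup> 'a) \<Rightarrow> bool" where
  "bounded_operator T \<longleftrightarrow> (\<exists>C. \<forall>x\<in>dom T. norm (the (T x)) \<le> C * norm x)"

definition symmetric_operator :: "('a::complex_inner \<rightharpoonup> 'a) \<Rightarrow> bool" where
  "symmetric_operator T \<longleftrightarrow> (\<forall>x\<in>dom T. \<forall>y\<in>dom T. cinner x (the (T y)) = cinner (the (T x)) y)"

section \<open>Orthogonal projections and their block entries\<close>

text \<open>
  The projection of \<open>x\<close> is the unique \<open>y \<in> M\<close> with \<open>x - y\<close> orthogonal to \<open>M\<close>; it exists for every
  closed subspace \<open>M\<close> of a Hilbert space.
\<close>

definition orth_proj :: "'a::complex_inner set \<Rightarrow> 'a \<Rightarrow> 'a" where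
  "orth_proj M x = (THE y. y \<in> M \<and> (\<forall>m\<in>M. cinner m (x - y) = 0))"

definition component :: "nat \<Rightarrow> 'a \<times> 'a \<Rightarrow> 'a" where
  "component j z = (if j = 1 then fst z else snd z)"

definition embed :: "nat \<Rightarrow> 'a \<Rightarrow> 'a::zero \<times> 'a" where
  "embed k x = (if k = 1 then (x, 0) else (0, x))"

text \<open>The \<open>(j, k)\<close> entry, \<open>j, k \<in> {1, 2}\<close>, of an operator on the direct sum.\<close>

definition block :: "('a::zero \<times> 'a \<Rightarrow> 'a \<times> 'a) \<Rightarrow> nat \<Rightarrow> nat \<Rightarrow> 'a \<Rightarrow> 'a" where
  "block P j k x = component j (P (embed k x))"

section \<open>Measurability of families\<close>

definition weakly_measurable_vectors :: "(real \<Rightarrow> 'a::complex_inner) \<Rightarrow> bool" where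
  "weakly_measurable_vectors g \<longleftrightarrow> (\<forall>h. (\<lambda>t. cinner h (g t)) \<in> borel_measurable lebesgue)"

definition weakly_measurable_operators :: "(real \<Rightarrow> 'a::complex_inner \<rightharpoonup> 'a) \<Rightarrow> bool" where
  "weakly_measurable_operators T \<longleftrightarrow>
    (\<forall>f. weakly_measurable_vectors f \<longrightarrow> (\<forall>t. f t \<in> dom (T t)) \<longrightarrow>
      weakly_measurable_vectors (\<lambda>t. the (T t (f t))))"

text \<open>The bounded entries enter as everywhere defined operators, via \<^term>\<open>Some\<close>.\<close>

definition N_measurable :: "(real \<Rightarrow> 'a::complex_inner \<rightharpoonup> 'a) \<Rightarrow> bool" where
  "N_measurable T \<longleftrightarrow> (\<forall>j\<in>{1, 2}. \<forall>k\<in>{1, 2}.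
    weakly_measurable_operators (\<lambda>t x. Some (block (orth_proj (Map.graph (T t))) j k x)))"

end

theory Submission
  imports Defs
begin

text \<open>
  Weak measurability: \<open>T\<^sub>0\<close> and \<open>T\<^sub>1\<close> agree on \<open>dom T\<^sub>0\<close>, so the family applied to \<open>f\<close> is
  \<open>T\<^sub>1 f(t)\<close>; against \<open>h \<in> dom T\<^sub>1\<close> symmetry moves \<open>T\<^sub>1\<close> to \<open>h\<close>, and density of \<open>dom T\<^sub>1\<close> gives the
  rest by a limit. Failure of \<open>N\<close>-measurability: a family that takes one value on a nonmeasurable
  set and another off it is measurable only if the two values coincide, so \<open>N\<close>-measurability would
  force the two graph projections to have equal blocks, hence the two graphs to be equal.
\<close>

section \<open>Complex inner product: conjugate linearity and continuity\<close>

lemma cinner_add_left: "cinner (x + y) z = cinner x z + cinner y (z::'a::complex_inner)"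
  using cinner_commute[of "x + y" z] cinner_commute[of x z] cinner_commute[of y z]
  by (simp add: cinner_add_right)

lemma cinner_scaleC_left: "cinner (a *\<^sub>C x) y = cnj a * cinner x (y::'a::complex_inner)"
  using cinner_commute[of "a *\<^sub>C x" y] cinner_commute[of x y] by (simp add: cinner_scaleC_right)

lemma cinner_diff_right: "cinner x (y - z) = cinner x y - cinner x (z::'a::complex_inner)"
  using cinner_add_right[of x "y - z" z] by simp

lemma cinner_self_eq_0_iff: "cinner x x = 0 \<longleftrightarrow> x = (0::'a::complex_inner)"
  by (simp add: cinner_self)

text \<open>The factor \<open>\<i>\<close> leaves the first slot as \<open>-\<i>\<close>, which
  turns the imaginary part into a real part. Complex orthogonality thus splits into two real
  orthogonality conditions.\<close>

lemma cinner_conv_inner: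
  "cinner x y = Complex (inner x y) (inner (\<i> *\<^sub>C x) (y::'a::complex_inner))"
  by (simp add: complex_eq_iff inner_eq_Re_cinner cinner_scaleC_left)

lemma tendsto_cinner_left:
  fixes y :: "'a::complex_inner"
  assumes "X \<longlonglongrightarrow> x"
  shows "(\<lambda>n. cinner (X n) y) \<longlonglongrightarrow> cinner x y"
proof -
  \<comment> \<open>Here \<open>\<i>\<close> sits on the fixed vector \<open>y\<close>, so only
    continuity of the real inner product in \<open>u\<close> is needed.\<close>
  have flip: "cinner u y = Complex (inner u y) (- inner u (\<i> *\<^sub>C y))" for u
    by (simp add: complex_eq_iff inner_eq_Re_cinner cinner_scaleC_right)
  show ?thesis
    unfolding flip by (intro tendsto_Complex tendsto_intros assms)
qed

section \<open>Orthogonal projection onto a closed subspace\<close>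

lemma parallelogram_law_midpoint:
  fixes x y z :: "'a::real_inner"
  shows "(norm (y - z))\<^sup>2 =
    2 * (norm (x - y))\<^sup>2 + 2 * (norm (x - z))\<^sup>2 - 4 * (norm (x - (1/2) *\<^sub>R (y + z)))\<^sup>2"
  by (simp add: power2_norm_eq_inner inner_commute algebra_simps)

text \<open>A minimizing sequence is Cauchy: midpoints of its terms stay in \<open>M\<close>, so the
  parallelogram law controls their mutual distance. Completeness and closedness then give the
  minimizer.\<close>

lemma exists_closest_point_subspace:
  fixes M :: "'a::{real_inner, complete_space} set"
  assumes "closed M" and "subspace M"
  shows "\<exists>y\<in>M. \<forall>m\<in>M. norm (x - y) \<le> norm (x - m)"
proof -
  define D where "D = (\<lambda>m. (norm (x - m))\<^sup>2) ` M"
  define d where "d = Inf D"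
  have bdd: "bdd_below D"
    unfolding D_def by (rule bdd_belowI[of _ 0]) auto
  have ne: "D \<noteq> {}"
    using subspace_0[OF assms(2)] unfolding D_def by blast
  have lower: "d \<le> (norm (x - m))\<^sup>2" if "m \<in> M" for m
    unfolding d_def by (rule cInf_lower[OF _ bdd]) (use that in \<open>simp add: D_def\<close>)
  have "\<exists>m\<in>M. (norm (x - m))\<^sup>2 < d + inverse (real (Suc n))" for n
  proof -
    have "Inf D < d + inverse (real (Suc n))"
      by (simp add: d_def)
    from cInf_lessD[OF ne this] show ?thesis
      unfolding D_def by blast
  qed
  then obtain Y where Y: "\<And>n. Y n \<in> M"
    and Yd: "\<And>n. (norm (x - Y n))\<^sup>2 < d + inverse (real (Suc n))"
    by metis
  \<comment> \<open>The midpoint contributes at most \<open>- 4 * d\<close>, which cancels the two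
    terms \<open>2 * d\<close>.\<close>
  have close: "(norm (Y m - Y n))\<^sup>2 < 2 * inverse (real (Suc m)) + 2 * inverse (real (Suc n))"
    for m n
  proof -
    have "(1/2) *\<^sub>R (Y m + Y n) \<in> M"
      using Y assms(2) by (intro subspace_scale subspace_add)
    from lower[OF this] show ?thesis
      using Yd[of m] Yd[of n] parallelogram_law_midpoint[of "Y m" "Y n" x] by linarith
  qed
  have "Cauchy Y"
  proof (rule metric_CauchyI)
    fix e :: real
    assume "0 < e"
    then obtain N where N: "inverse (real (Suc N)) < e\<^sup>2 / 4"
      using reals_Archimedean[of "e\<^sup>2 / 4"] by auto
    have "dist (Y m) (Y n) < e" if "N \<le> m" "N \<le> n" for m n
    proof -
      have "inverse (real (Suc m)) \<le> inverse (real (Suc N))"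
        "inverse (real (Suc n)) \<le> inverse (real (Suc N))"
        using that by (simp_all add: le_imp_inverse_le)
      with close[of m n] N have "(norm (Y m - Y n))\<^sup>2 < e\<^sup>2"
        by linarith
      then show ?thesis
        using \<open>0 < e\<close> by (simp add: dist_norm power2_less_imp_less)
    qed
    then show "\<exists>N. \<forall>m\<ge>N. \<forall>n\<ge>N. dist (Y m) (Y n) < e"
      by blast
  qed
  then obtain y where lim: "Y \<longlonglongrightarrow> y"
    using Cauchy_convergent convergent_def by blast
  have "y \<in> M"
    using closed_sequentially[OF assms(1) Y lim] .
  moreover have "norm (x - y) \<le> norm (x - m)" if "m \<in> M" for m
  proof -
    have "(\<lambda>n. d + inverse (real (Suc n))) \<longlonglongrightarrow> d + 0"
      by (intro tendsto_intros LIMSEQ_inverse_real_of_nat)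
    moreover have "(\<lambda>n. (norm (x - Y n))\<^sup>2) \<longlonglongrightarrow> (norm (x - y))\<^sup>2"
      by (intro tendsto_intros lim)
    ultimately have "(norm (x - y))\<^sup>2 \<le> d + 0"
      using Yd by (intro LIMSEQ_le) (auto intro: less_imp_le)
    with lower[OF that] have "(norm (x - y))\<^sup>2 \<le> (norm (x - m))\<^sup>2"
      by linarith
    then show ?thesis
      by (rule power2_le_imp_le) simp
  qed
  ultimately show ?thesis
    by blast
qed

lemma closest_point_orthogonal:
  fixes x y m :: "'a::real_inner"
  assumes "subspace M" and "y \<in> M" and "\<And>m. m \<in> M \<Longrightarrow> norm (x - y) \<le> norm (x - m)"
    and "m \<in> M"
  shows "inner m (x - y) = 0"
proof (cases "m = 0")
  case False
  \<comment> \<open>This \<open>s\<close> minimizes the quadratic norm of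
    \<open>(x - y) - s *\<^sub>R m\<close>; a nonzero inner product would make
    \<open>y + s *\<^sub>R m\<close> strictly closer to \<open>x\<close>.\<close>
  define s where "s = inner m (x - y) / (norm m)\<^sup>2"
  have "norm (x - y) \<le> norm (x - (y + s *\<^sub>R m))"
    using assms by (intro assms(3) subspace_add subspace_scale)
  then have "(norm (x - y))\<^sup>2 \<le> (norm ((x - y) - s *\<^sub>R m))\<^sup>2"
    by (intro power_mono) (simp_all add: algebra_simps)
  also have "\<dots> = (norm (x - y))\<^sup>2 - 2 * s * inner m (x - y) + s\<^sup>2 * (norm m)\<^sup>2"
    unfolding power2_norm_eq_inner
    by (simp add: inner_diff_left inner_diff_right inner_commute power2_eq_square algebra_simps)
  also have "\<dots> = (norm (x - y))\<^sup>2 - (inner m (x - y))\<^sup>2 / (norm m)\<^sup>2"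
    using False by (simp add: s_def power2_eq_square field_simps)
  finally have "(inner m (x - y))\<^sup>2 / (norm m)\<^sup>2 \<le> 0"
    by simp
  with False show ?thesis
    by (simp add: divide_le_0_iff)
qed simp

lemma csubspace_imp_subspace: "csubspace M \<Longrightarrow> subspace M"
  by (simp add: cvec.subspace_def subspace_def scaleR_scaleC)

text \<open>The definite description in \<open>orth_proj\<close> is justified by existence, from the
  closest point, and uniqueness.\<close>

lemma orth_proj_props:
  fixes M :: "'a::{complex_inner, complete_space} set"
  assumes "closed M" and "csubspace M"
  shows orth_proj_in: "orth_proj M x \<in> M"
    and orth_proj_orthogonal: "m \<in> M \<Longrightarrow> cinner m (x - orth_proj M x) = 0"
proof -
  let ?P = "\<lambda>y. y \<in> M \<and> (\<forall>m\<in>M. cinner m (x - y) = 0)"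
  note sub = csubspace_imp_subspace[OF assms(2)]
  obtain y where y: "y \<in> M" and min: "\<And>m. m \<in> M \<Longrightarrow> norm (x - y) \<le> norm (x - m)"
    using exists_closest_point_subspace[OF assms(1) sub] by blast
  \<comment> \<open>Real orthogonality is applied to both \<open>m\<close> and
    \<open>\<i> *\<^sub>C m\<close>, which lie in \<open>M\<close> because it is a complex
    subspace.\<close>
  have "?P y"
    using y closest_point_orthogonal[OF sub y min] cvec.subspace_scale[OF assms(2)]
    by (simp add: cinner_conv_inner complex_eq_iff)
  moreover have "z = w" if "?P z" "?P w" for z w
  proof -
    have "z - w \<in> M"
      using that cvec.subspace_diff[OF assms(2)] by blast
    \<comment> \<open>The second argument equals \<open>z - w\<close>, so this says that
      \<open>z - w\<close> is orthogonal to itself.\<close>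
    with that have "cinner (z - w) ((x - w) - (x - z)) = 0"
      by (subst cinner_diff_right) simp
    then show ?thesis
      by (simp add: cinner_self_eq_0_iff)
  qed
  ultimately have "?P (orth_proj M x)"
    unfolding orth_proj_def by (intro theI[of ?P y]) blast+
  then show "orth_proj M x \<in> M" "m \<in> M \<Longrightarrow> cinner m (x - orth_proj M x) = 0"
    by blast+
qed

section \<open>Graphs and the blocks of their projections\<close>

lemma csubspace_graph:
  assumes "linear_operator T"
  shows "csubspace (Map.graph T)"
proof -
  have dom: "csubspace (dom T)"
    and add: "\<And>x y. x \<in> dom T \<Longrightarrow> y \<in> dom T \<Longrightarrow> the (T (x + y)) = the (T x) + the (T y)"
    and scale: "\<And>c x. x \<in> dom T \<Longrightarrow> the (T (c *\<^sub>C x)) = c *\<^sub>C the (T x)"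
    using assms unfolding linear_operator_def by blast+
  have graph: "z \<in> Map.graph T \<longleftrightarrow> fst z \<in> dom T \<and> the (T (fst z)) = snd z" for z
    by (cases z) (auto simp: Map.graph_def)
  have "the (T 0) = 0"
    using add[of 0 0] cvec.subspace_0[OF dom] by simp
  then show ?thesis
    using cvec.subspace_0[OF dom] cvec.subspace_add[OF dom] cvec.subspace_scale[OF dom]
    by (auto simp: cvec.subspace_def graph add scale scaleC_prod_def)
qed

text \<open>Each \<open>z\<close> in \<open>N\<close> is the sum of its two embedded components. The
  sum of their projections lies in \<open>M\<close>, and its difference from \<open>z\<close> is
  both in \<open>N\<close> and orthogonal to \<open>N\<close>, hence zero. Linearity of
  \<open>orth_proj\<close> is never invoked.\<close>

lemma subset_if_orth_proj_embed_eq: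
  fixes M N :: "('a::{complex_inner, complete_space} \<times> 'a) set"
  assumes M: "closed M" "csubspace M" and N: "closed N" "csubspace N" and "M \<subseteq> N"
    and eq: "\<And>k x. k \<in> {1, 2} \<Longrightarrow> orth_proj M (embed k x) = orth_proj N (embed k x)"
  shows "N \<subseteq> M"
proof
  fix z
  assume "z \<in> N"
  define p where "p = orth_proj M (embed 1 (fst z))"
  define q where "q = orth_proj M (embed 2 (snd z))"
  have "p + q \<in> M"
    unfolding p_def q_def by (intro cvec.subspace_add M orth_proj_in)
  have split: "z - (p + q) = (embed 1 (fst z) - p) + (embed 2 (snd z) - q)"
    by (cases z) (simp add: embed_def prod_eq_iff)
  have "cinner m (z - (p + q)) = 0" if "m \<in> N" for m
  proof -
    have "cinner m (embed 1 (fst z) - p) = 0" "cinner m (embed 2 (snd z) - q) = 0"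
      using orth_proj_orthogonal[OF N that] by (simp_all add: p_def q_def eq)
    then show ?thesis
      by (simp only: split cinner_add_right add_0)
  qed
  moreover have "z - (p + q) \<in> N"
    using \<open>z \<in> N\<close> \<open>p + q \<in> M\<close> \<open>M \<subseteq> N\<close> cvec.subspace_diff[OF N(2)] by blast
  ultimately have "z - (p + q) = 0"
    using cinner_self_eq_0_iff by blast
  with \<open>p + q \<in> M\<close> show "z \<in> M"
    by simp
qed

section \<open>Measurability of vector families\<close>

lemma weakly_measurable_vectors_two_valued:
  assumes "weakly_measurable_vectors (\<lambda>t. if t \<in> E then a else b)" and "E \<notin> sets lebesgue"
  shows "a = b"
proof (rule ccontr)
  assume "a \<noteq> b"
  let ?f = "\<lambda>t. cinner (a - b) (if t \<in> E then a else b)"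
  \<comment> \<open>The two values differ by \<open>cinner (a - b) (a - b)\<close>, so testing
    against \<open>a - b\<close> separates them and exhibits \<open>E\<close> as the preimage of a
    point.\<close>
  have "cinner (a - b) a \<noteq> cinner (a - b) b"
    using \<open>a \<noteq> b\<close> cinner_diff_right[of "a - b" a b] cinner_self_eq_0_iff[of "a - b"] by auto
  then have "E = ?f -` {cinner (a - b) a} \<inter> space lebesgue"
    by (auto split: if_splits)
  also have "\<dots> \<in> sets lebesgue"
    using assms(1) unfolding weakly_measurable_vectors_def
    by (intro measurable_sets[where A = borel]) auto
  finally show False
    using assms(2) by blast
qed

lemma weakly_measurable_vectors_const: "weakly_measurable_vectors (\<lambda>t. x)"
  by (simp add: weakly_measurable_vectors_def)

lemma weakly_measurable_symmetric_operator:
  assumes "densely_defined T" and "symmetric_operator T"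
    and f: "weakly_measurable_vectors f" "\<And>t. f t \<in> dom T"
  shows "weakly_measurable_vectors (\<lambda>t. the (T (f t)))"
  unfolding weakly_measurable_vectors_def
proof
  fix h
  have "h \<in> closure (dom T)"
    using assms(1) by (simp add: densely_defined_def)
  then obtain X where X: "\<And>n. X n \<in> dom T" and lim: "X \<longlonglongrightarrow> h"
    unfolding closure_sequential by blast
  show "(\<lambda>t. cinner h (the (T (f t)))) \<in> borel_measurable lebesgue"
  proof (rule borel_measurable_LIMSEQ_metric)
    fix n
    have "cinner (X n) (the (T (f t))) = cinner (the (T (X n))) (f t)" for t
      using assms(2) X f(2) unfolding symmetric_operator_def by blast
    then show "(\<lambda>t. cinner (X n) (the (T (f t)))) \<in> borel_measurable lebesgue"
      using f(1) by (simp add: weakly_measurable_vectors_def)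
  qed (rule tendsto_cinner_left[OF lim])
qed

section \<open>The family switching between two nested symmetric operators\<close>

theorem mainTheorem1:
  fixes T0 T1 :: "'a::{complex_inner, complete_space} \<rightharpoonup> 'a"
    and E :: "real set"
  assumes "separable_space (euclidean :: 'a topology)"
    and "linear_operator T0" and "densely_defined T0" and "closed_operator T0"
    and "\<not> bounded_operator T0" and "symmetric_operator T0"
    and "linear_operator T1" and "densely_defined T1" and "closed_operator T1"
    and "\<not> bounded_operator T1" and "symmetric_operator T1"
    and "T0 \<subseteq>\<^sub>m T1" and "T0 \<noteq> T1"
    and "E \<notin> sets lebesgue"
  shows "weakly_measurable_operators (\<lambda>t. if t \<in> E then T0 else T1)
    \<and> \<not> N_measurable (\<lambda>t. if t \<in> E then T0 else T1)"
proof
  let ?T = "\<lambda>t. if t \<in> E then T0 else T1"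
  show "weakly_measurable_operators ?T"
    unfolding weakly_measurable_operators_def
  proof (intro allI impI)
    fix f :: "real \<Rightarrow> 'a"
    assume f: "weakly_measurable_vectors f" and dom: "\<forall>t. f t \<in> dom (?T t)"
    have eq: "?T t (f t) = T1 (f t)" for t
      using dom[rule_format, of t] \<open>T0 \<subseteq>\<^sub>m T1\<close> by (auto simp: map_le_def split: if_splits)
    then have "f t \<in> dom T1" for t
      using dom by (metis domIff)
    then have "weakly_measurable_vectors (\<lambda>t. the (T1 (f t)))"
      using weakly_measurable_symmetric_operator assms f by blast
    then show "weakly_measurable_vectors (\<lambda>t. the (?T t (f t)))"
      by (simp only: eq)
  qed
  show "\<not> N_measurable ?T"
  proof
    assume N: "N_measurable ?T"
    let ?P = "\<lambda>T. orth_proj (Map.graph T)"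
    have block: "block (?P T0) j k x = block (?P T1) j k x" if "j \<in> {1, 2}" "k \<in> {1, 2}" for j k x
    proof (rule weakly_measurable_vectors_two_valued)
      have "weakly_measurable_operators (\<lambda>t x. Some (block (?P (?T t)) j k x))"
        using N that unfolding N_measurable_def by blast
      then have "weakly_measurable_vectors (\<lambda>t. block (?P (?T t)) j k x)"
        unfolding weakly_measurable_operators_def
        \<comment> \<open>The blocks are everywhere defined, so the constant family \<open>x\<close>
          is an admissible test family.\<close>
        using weakly_measurable_vectors_const[of x] by (auto dest!: spec[of _ "\<lambda>t. x"])
      then show "weakly_measurable_vectors
          (\<lambda>t. if t \<in> E then block (?P T0) j k x else block (?P T1) j k x)"
        by (simp add: if_distrib[of "\<lambda>T. block (?P T) j k x"])
    qed (rule \<open>E \<notin> sets lebesgue\<close>)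
    have proj: "?P T0 (embed k x) = ?P T1 (embed k x)" if "k \<in> {1, 2}" for k x
      using block[of 1 k x] block[of 2 k x] that
      by (simp add: block_def component_def prod_eq_iff)
    have graph_le: "Map.graph T0 \<subseteq> Map.graph T1"
      using \<open>T0 \<subseteq>\<^sub>m T1\<close> by (force simp: Map.graph_def map_le_def)
    have closed: "closed (Map.graph T0)" "closed (Map.graph T1)"
      using assms by (simp_all add: closed_operator_def)
    have "Map.graph T1 \<subseteq> Map.graph T0"
      by (rule subset_if_orth_proj_embed_eq[OF closed(1) csubspace_graph closed(2) csubspace_graph
          graph_le proj]) (fact assms | assumption)+
    with graph_le have "T0 x = Some y \<longleftrightarrow> T1 x = Some y" for x y
      by (auto simp: Map.graph_def)
    \<comment> \<open>The values \<open>Some y\<close> determine a partial function: where neither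
      map has one, both are \<open>None\<close>.\<close>
    then have "T0 x = T1 x" for x
      by (metis option.exhaust)
    with \<open>T0 \<noteq> T1\<close> show False
      by blast
  qed
qed

end
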